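(* Let $\Sigma\ni 0$ be a set of execution modes and, for each $\sigma\in\Sigma$, let $A_\sigma:\mathbb{R}^n\to\mathbb{R}^n$. Consider the system $$x_{k+1}=A_{\sigma_k}(x_k)+w_k,\qquad \sigma_k\in\Sigma,\ w_k\in\mathbb{R}^n,\ x_0\in\mathbb{R}^n,\ k\in\mathbb{N}_0 .$$ Let $\gamma_i\ge 0$, $i\in\Sigma$, be given by $\gamma_i=\|A_i-A_0\|_2$ in the linear case (where $A_i(x)=A_i x$ with $A_i\in\mathbb{R}^{n\times n}$) or, in general, be bounds such that $\gamma_0=0$ and $$|A_\sigma(x)-A_0(x)|\le\gamma_\sigma|x|\qquad\forall x\in\mathbb{R}^n,\ \forall\sigma\in\Sigma .$$ Let $\rho\in(0,1)$, $\alpha\ge1$, $\beta\ge1$ be valid parameters of the nominal abstraction, i.e. for every $x_0\in\mathbb{R}^n$ and every sequence $(w_k)$ in $\mathbb{R}^n$, the solution of $x_{k+1}=A_0(x_k)+w_k$ satisfies $|x_k|\le v_k$ for all $k\ge0$, where $$v_{k+1}=\rho v_k+\beta|w_k|,\qquad v_0=\alpha|x_0| .$$ Define $\rho_\sigma:=\rho+\beta\gamma_\sigma$ for $\sigma\in\Sigma$. Then the same $\alpha,\beta$ together with $(\rho_\sigma)_{\sigma\in\Sigma}$ are valid parameters of the abstraction for weak execution: for every $x_0\in\mathbb{R}^n$, every sequence $(\sigma_k)$ in $\Sigma$ and every sequence $(w_k)$ in $\mathbb{R}^n$, the solution of $x_{k+1}=A_{\sigma_k}(x_k)+w_k$ satisfies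 $$|x_k|\le\bar v_k\quad\forall k\ge0,\qquad\text{where}\quad \bar v_{k+1}=\rho_{\sigma_k}\bar v_k+\beta|w_k|,\quad \bar v_0=\alpha|x_0| .$$
   Context: $\mathbb{N}_0=\{0,1,2,\dots\}$; $|\cdot|$ is the Euclidean norm on $\mathbb{R}^n$ and $\|\cdot\|_2$ the induced spectral norm of a matrix. The mode $\sigma_k=0$ is nominal execution of the controller in step $k$; $\sigma_k\ne0$ is any deviation from it. *)

theory Defs
  imports "HOL-Analysis.Analysis"
begin

primrec solution ::
  "(nat \<Rightarrow> real^'n \<Rightarrow> real^'n) \<Rightarrow> (nat \<Rightarrow> real^'n) \<Rightarrow> real^'n \<Rightarrow> nat \<Rightarrow> real^'n"
where
  "solution F w x0 0 = x0"
| "solution F w x0 (Suc k) = F k (solution F w x0 k) + w k"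

primrec comparison ::
  "(nat \<Rightarrow> real) \<Rightarrow> real \<Rightarrow> (nat \<Rightarrow> real^'n) \<Rightarrow> real \<Rightarrow> nat \<Rightarrow> real"
where
  "comparison r \<beta> w v0 0 = v0"
| "comparison r \<beta> w v0 (Suc k) = r k * comparison r \<beta> w v0 k + \<beta> * norm (w k)"

definition valid_nominal_abstraction ::
  "(real^'n \<Rightarrow> real^'n) \<Rightarrow> real \<Rightarrow> real \<Rightarrow> real \<Rightarrow> bool"
where
  "valid_nominal_abstraction A0 \<rho> \<alpha> \<beta> \<longleftrightarrow>
     (\<forall>x0 w k. norm (solution (\<lambda>_. A0) w x0 k) \<le> comparison (\<lambda>_. \<rho>) \<beta> w (\<alpha> * norm x0) k)"

definition valid_weak_abstraction ::
  "'m set \<Rightarrow> ('m \<Rightarrow> real^'n \<Rightarrow> real^'n) \<Rightarrow> ('m \<Rightarrow> real) \<Rightarrow> real \<Rightarrow> real \<Rightarrow> bool"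
where
  "valid_weak_abstraction \<Sigma> A r \<alpha> \<beta> \<longleftrightarrow>
     (\<forall>x0 \<sigma> w. (\<forall>k. \<sigma> k \<in> \<Sigma>) \<longrightarrow>
        (\<forall>k. norm (solution (\<lambda>k. A (\<sigma> k)) w x0 k)
              \<le> comparison (\<lambda>k. r (\<sigma> k)) \<beta> w (\<alpha> * norm x0) k))"

(* norm on real^'n is the Euclidean norm, so onorm is the induced spectral norm;
   norm on the matrix type itself would be the Frobenius norm. *)
definition spectral_norm :: "real^'n^'n \<Rightarrow> real"
  where "spectral_norm M = onorm (\<lambda>x. M *v x)"

definition linear_case_gains ::
  "'m::zero set \<Rightarrow> ('m \<Rightarrow> real^'n \<Rightarrow> real^'n) \<Rightarrow> ('m \<Rightarrow> real) \<Rightarrow> bool"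
where
  "linear_case_gains \<Sigma> A \<gamma> \<longleftrightarrow>
     (\<exists>M. (\<forall>i\<in>\<Sigma>. \<forall>x. A i x = M i *v x) \<and> (\<forall>i\<in>\<Sigma>. \<gamma> i = spectral_norm (M i - M 0)))"

definition general_case_gains ::
  "'m::zero set \<Rightarrow> ('m \<Rightarrow> real^'n \<Rightarrow> real^'n) \<Rightarrow> ('m \<Rightarrow> real) \<Rightarrow> bool"
where
  "general_case_gains \<Sigma> A \<gamma> \<longleftrightarrow>
     \<gamma> 0 = 0 \<and> (\<forall>x. \<forall>\<sigma>\<in>\<Sigma>. norm (A \<sigma> x - A 0 x) \<le> \<gamma> \<sigma> * norm x)"

end

(* The weak execution is a nominal execution driven by the disturbance
   d k = A (\<sigma> k) (x k) - A 0 (x k) + w k.  Its nominal bound v dominates norm (x k), so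
   norm (d k) \<le> \<gamma> (\<sigma> k) * v k + norm (w k): the mismatch can be absorbed into the rate of v. *)
theory Submission
  imports Defs
begin

text \<open>Merges the two readings of \<gamma> into the one estimate used later. In the linear case
  it is the operator norm inequality for \<open>M \<sigma> - M 0\<close>;
  \<open>0 \<in> \<Sigma>\<close> is what lets \<open>A 0\<close> be represented by
  \<open>M 0\<close>.\<close>

lemma gains_bound:
  fixes A :: "'m::zero \<Rightarrow> real^'n \<Rightarrow> real^'n"
  assumes "0 \<in> \<Sigma>" "linear_case_gains \<Sigma> A \<gamma> \<or> general_case_gains \<Sigma> A \<gamma>" "\<sigma> \<in> \<Sigma>"
  shows "norm (A \<sigma> x - A 0 x) \<le> \<gamma> \<sigma> * norm x"
  using assms(2)
proof
  assume "linear_case_gains \<Sigma> A \<gamma>"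
  then obtain M where M: "\<forall>i\<in>\<Sigma>. \<forall>x. A i x = M i *v x"
    and \<gamma>: "\<forall>i\<in>\<Sigma>. \<gamma> i = spectral_norm (M i - M 0)"
    unfolding linear_case_gains_def by blast
  have "A \<sigma> x - A 0 x = (M \<sigma> - M 0) *v x"
    using M assms(1,3) by (simp add: matrix_vector_mult_diff_rdistrib)
  then show ?thesis
    using \<gamma> assms(3) onorm[OF matrix_vector_mul_bounded_linear, of "M \<sigma> - M 0" x]
    by (simp add: spectral_norm_def)
next
  assume "general_case_gains \<Sigma> A \<gamma>"
  then show ?thesis
    using assms(3) by (simp add: general_case_gains_def)
qed

text \<open>Along the trajectory of \<open>F\<close>, the added disturbance cancels the
  \<open>G\<close> term and restores the \<open>F\<close> term, so both recursions take the same
  step.\<close>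

lemma solution_as_perturbation:
  "solution F w x0 k = solution G (\<lambda>j. F j (solution F w x0 j) - G j (solution F w x0 j) + w j) x0 k"
  by (induction k) simp_all

text \<open>The bound on \<open>d k\<close> is affine in the current comparison value, so inserting
  it into the recursion raises the rate by \<open>\<beta> * g k\<close> and leaves only
  \<open>w\<close> as input.\<close>

lemma comparison_absorb:
  fixes w d :: "nat \<Rightarrow> real^'n"
  assumes "0 \<le> \<rho>" "0 \<le> \<beta>" "\<And>k. 0 \<le> g k"
    and "\<And>k. norm (d k) \<le> g k * comparison (\<lambda>_. \<rho>) \<beta> d v0 k + norm (w k)"
  shows "comparison (\<lambda>_. \<rho>) \<beta> d v0 k \<le> comparison (\<lambda>k. \<rho> + \<beta> * g k) \<beta> w v0 k"
proof (induction k)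
  case (Suc k)
  let ?v = "comparison (\<lambda>_. \<rho>) \<beta> d v0 k"
  have "comparison (\<lambda>_. \<rho>) \<beta> d v0 (Suc k) \<le> \<rho> * ?v + \<beta> * (g k * ?v + norm (w k))"
    using mult_left_mono[OF assms(4) assms(2), of k] by simp
  also have "\<dots> = (\<rho> + \<beta> * g k) * ?v + \<beta> * norm (w k)"
    by (simp add: algebra_simps)
  \<comment> \<open>The induction hypothesis may be multiplied by the new rate because that rate is
    nonnegative.\<close>
  also have "\<dots> \<le> comparison (\<lambda>k. \<rho> + \<beta> * g k) \<beta> w v0 (Suc k)"
    using mult_left_mono[OF Suc.IH, of "\<rho> + \<beta> * g k"] assms(1-3) by simp
  finally show ?case .
qed simp

theorem theorem6p2:
  fixes \<Sigma> :: "'m::zero set"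
    and A :: "'m \<Rightarrow> real^'n \<Rightarrow> real^'n"
    and \<gamma> :: "'m \<Rightarrow> real"
    and \<rho> \<alpha> \<beta> :: real
  assumes "0 \<in> \<Sigma>"
    and "\<forall>i\<in>\<Sigma>. 0 \<le> \<gamma> i"
    and "linear_case_gains \<Sigma> A \<gamma> \<or> general_case_gains \<Sigma> A \<gamma>"
    and "0 < \<rho>" and "\<rho> < 1" and "1 \<le> \<alpha>" and "1 \<le> \<beta>"
    and "valid_nominal_abstraction (A 0) \<rho> \<alpha> \<beta>"
  shows "valid_weak_abstraction \<Sigma> A (\<lambda>\<sigma>. \<rho> + \<beta> * \<gamma> \<sigma>) \<alpha> \<beta>"
  unfolding valid_weak_abstraction_def
proof (intro allI impI)
  fix x0 :: "real^'n" and \<sigma> :: "nat \<Rightarrow> 'm" and w :: "nat \<Rightarrow> real^'n" and k :: nat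
  assume \<sigma>: "\<forall>k. \<sigma> k \<in> \<Sigma>"
  define x where "x = solution (\<lambda>k. A (\<sigma> k)) w x0"
  define d where "d = (\<lambda>j. A (\<sigma> j) (x j) - A 0 (x j) + w j)"
  let ?v = "comparison (\<lambda>_. \<rho>) \<beta> d (\<alpha> * norm x0)"
  have x: "x j = solution (\<lambda>_. A 0) d x0 j" for j
    unfolding x_def d_def by (rule solution_as_perturbation)
  \<comment> \<open>Nominal validity covers every disturbance sequence, hence also \<open>d\<close>,
    although \<open>d\<close> is built from the trajectory itself.\<close>
  have xv: "norm (x j) \<le> ?v j" for j
    using assms(8) unfolding x valid_nominal_abstraction_def by blast
  have d_le: "norm (d j) \<le> \<gamma> (\<sigma> j) * ?v j + norm (w j)" for j
  proof -
    have "norm (d j) \<le> norm (A (\<sigma> j) (x j) - A 0 (x j)) + norm (w j)"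
      unfolding d_def by (rule norm_triangle_ineq)
    also have "\<dots> \<le> \<gamma> (\<sigma> j) * norm (x j) + norm (w j)"
      using gains_bound[OF assms(1,3)] \<sigma> by simp
    \<comment> \<open>Trading the state for its nominal bound, by \<gamma> \<ge> 0, makes the
      estimate refer to \<open>?v\<close> alone, as \<open>comparison_absorb\<close>
      requires.\<close>
    also have "\<dots> \<le> \<gamma> (\<sigma> j) * ?v j + norm (w j)"
      using assms(2) \<sigma> by (simp add: mult_left_mono[OF xv])
    finally show ?thesis .
  qed
  have "?v k \<le> comparison (\<lambda>k. \<rho> + \<beta> * \<gamma> (\<sigma> k)) \<beta> w (\<alpha> * norm x0) k"
    using assms(2,4,7) \<sigma> by (intro comparison_absorb d_le) auto
  with xv[of k] show "norm (solution (\<lambda>k. A (\<sigma> k)) w x0 k)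
      \<le> comparison (\<lambda>k. \<rho> + \<beta> * \<gamma> (\<sigma> k)) \<beta> w (\<alpha> * norm x0) k"
    unfolding x_def by linarith
qed

end
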